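(* Let $d \ge 4$, let $a \in \mathbb{R}^d$ with $a \neq 0$, let $\sigma_X^2, \sigma_Y^2 > 0$, and let $\mathcal{L}_1, \mathcal{L}_2$ be cdfs on $\mathbb{R}$, all known. For unknown $\theta \in \mathbb{R}^d$, let $X|\theta \sim MMN_d(\theta, a, \sigma_X^2 I_d, \mathcal{L}_1)$ and $Y|\theta \sim MMN_d(\theta, a, \sigma_Y^2 I_d, \mathcal{L}_2)$ be independently distributed, and consider the problem of obtaining, based on $X$, a predictive density estimator $\hat{q}(y;X)$, $y \in \mathbb{R}^d$, for the density of $Y$. Let $\mathcal{L}_3$ be the cdf of $V_2 - V_1$, where $V_1 \sim \mathcal{L}_1$ and $V_2 \sim \mathcal{L}_2$ are independent, and let $\hat{q}_U(\cdot;X)$ be the minimum risk equivariant (MRE) predictive density, namely the $MMN_d(X, a, (\sigma_X^2+\sigma_Y^2) I_d, \mathcal{L}_3)$ density. Let $H = \begin{pmatrix} h_1^{\top} \\ H_2 \end{pmatrix}$ be a $d \times d$ orthogonal matrix with first row $h_1^\top$, where $h_1 = a/\|a\|$, and $H_2$ of size $(d-1)\times d$. For an estimator $\hat{\zeta}_2 : \mathbb{R}^{d-1} \to \mathbb{R}^{d-1}$, let $q_1(\cdot;X)$ be the density of the $MMN_1(h_1^\top X, \|a\|, \sigma_X^2 + \sigma_Y^2, \mathcal{L}_3)$ distribution and let $q_{2,\hat{\zeta}_2}(\cdot;X)$ be the density of the $N_{d-1}\left(\hat{\zeta}_2(H_2 X), (\sigma_X^2+\sigma_Y^2) I_{d-1}\right)$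 distribution. Then the predictive density $$ q_{H,\hat{\zeta}_2}(y;X) = q_1(h_1^\top y; X) \times q_{2,\hat{\zeta}_2}(H_2 y; X), \quad y \in \mathbb{R}^d, $$ dominates $\hat{q}_U$ under Kullback-Leibler loss if and only if $\hat{\zeta}_2(Z_2)$ dominates $Z_2$ as an estimator of $\zeta_{(2)} \in \mathbb{R}^{d-1}$ under squared error loss $\|\hat{\zeta}_2 - \zeta_{(2)}\|^2$ for the model $Z_2|\zeta_{(2)} \sim N_{d-1}(\zeta_{(2)}, \sigma_X^2 I_{d-1})$.
   Context: A random vector $X \in \mathbb{R}^d$ has a mean-mixture of normal distributions, written $X \sim MMN_d(\theta, a, \Sigma, \mathcal{L})$, if $X|V=v \sim N_d(\theta + v a, \Sigma)$ with $V \sim \mathcal{L}$, where $\theta\in\mathbb{R}^d$ is a location parameter, $a \in \mathbb{R}^d$ a perturbation vector, $\Sigma$ a positive definite matrix, and $V$ a scalar random variable with cdf $\mathcal{L}$. Let $p(\cdot|\theta)$ and $q(\cdot|\theta)$ denote the conditional densities of $X$ and $Y$ given $\theta$. The Kullback-Leibler risk of a predictive density estimator $\hat{q}(\cdot;X)$ is $R_{KL}(\theta,\hat{q}) = \int_{\mathbb{R}^d} \left\{ \int_{\mathbb{R}^d} q(y|\theta) \log \frac{q(y|\theta)}{\hat{q}(y;x)}\, dy \right\} p(x|\theta)\, dx$. One predictive density (respectively, point estimator) dominates another if its risk (expected loss) is less than or equal to that of the other for all parameter values, with strict inequality for at least one parameter value.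
   Formalization: Added assumption: the Kullback-Leibler risk of the MRE density is finite for some θ. Without it the "if" part fails: for V_2=0 and V_1 with density ∝ 1/(|v| log²|v|), |v|>e, both KL risks are infinite for all θ, yet a James-Stein estimator dominates Z_2. *)

theory Defs
  imports "HOL-Probability.Probability"
begin

definition mvn_density :: "real^'n \<Rightarrow> real^'n^'n \<Rightarrow> real^'n \<Rightarrow> real" where
  "mvn_density \<mu> \<Sigma> x =
     exp (- ((x - \<mu>) \<bullet> (matrix_inv \<Sigma> *v (x - \<mu>))) / 2) / sqrt ((2 * pi) ^ CARD('n) * det \<Sigma>)"

definition mvn :: "real^'n \<Rightarrow> real^'n^'n \<Rightarrow> (real^'n) measure" where
  "mvn \<mu> \<Sigma> = density lborel (\<lambda>x. ennreal (mvn_density \<mu> \<Sigma> x))"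

(* A cdf on the real line is represented by its law, a real_distribution; the cdf itself is then
   "cdf L". The density below is the mixture over v \<sim> L of the N(\<theta> + v a, \<Sigma>)-densities; see
   emeasure_mmn_density for its relation to the hierarchical definition of the distribution. *)

definition mmn_density ::
  "real^'n \<Rightarrow> real^'n \<Rightarrow> real^'n^'n \<Rightarrow> real measure \<Rightarrow> real^'n \<Rightarrow> real" where
  "mmn_density \<theta> a \<Sigma> L x = (\<integral>v. mvn_density (\<theta> + v *\<^sub>R a) \<Sigma> x \<partial>L)"

lemma continuous_mvn_density:
  fixes \<theta> a :: "real^'n"
  shows "continuous_on UNIV (\<lambda>(v, x). mvn_density (\<theta> + v *\<^sub>R a) \<Sigma> x)"
proof -
  have "continuous_on UNIV (\<lambda>p::real \<times> (real^'n).
          matrix_inv \<Sigma> *v (snd p - (\<theta> + fst p *\<^sub>R a)))"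
    by (rule linear_continuous_on_compose[OF _ matrix_vector_mul_linear]) (intro continuous_intros)
  then show ?thesis
    unfolding mvn_density_def case_prod_beta divide_inverse
    by (intro continuous_intros)
qed

lemma det_pos_of_positive_definite:
  fixes \<Sigma> :: "real^'n^'n"
  assumes pd: "\<And>x. x \<noteq> 0 \<Longrightarrow> 0 < x \<bullet> (\<Sigma> *v x)"
  shows "0 < det \<Sigma>"
proof (rule ccontr)
  assume neg: "\<not> 0 < det \<Sigma>"
  define M where "M t = (1 - t) *\<^sub>R mat 1 + t *\<^sub>R \<Sigma>" for t :: real
  have "continuous_on {0..1} (\<lambda>t. det (M t))"
    unfolding det_def M_def by (intro continuous_intros)
  moreover have "det (M 1) \<le> 0" "0 \<le> det (M 0)"
    using neg by (simp_all add: M_def)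
  ultimately obtain t where t: "0 \<le> t" "t \<le> 1" "det (M t) = 0"
    using IVT2'[of "\<lambda>t. det (M t)" 1 0 0] by auto
  then obtain x where x: "x \<noteq> 0" "M t *v x = 0"
    by (metis invertible_det_nz invertible_left_inverse matrix_left_invertible_ker)
  have "x \<bullet> (M t *v x) = (1 - t) * (x \<bullet> x) + t * (x \<bullet> (\<Sigma> *v x))"
    by (simp add: M_def matrix_vector_mult_add_rdistrib scaleR_matrix_vector_assoc[symmetric] inner_add_right)
  moreover have "0 < x \<bullet> x" "0 < x \<bullet> (\<Sigma> *v x)" using x pd by auto
  ultimately show False
    using t x by (cases "t = 0") (auto simp: add_nonneg_eq_0_iff)
qed

(* If V has law L and X given V = v is N(\<theta> + v a, \<Sigma>)-distributed, the left-hand side below is the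
   probability that X lies in A. *)

lemma emeasure_mmn_density:
  fixes \<Sigma> :: "real^'n^'n"
  assumes L: "real_distribution L"
    and pd: "\<And>x. x \<noteq> 0 \<Longrightarrow> 0 < x \<bullet> (\<Sigma> *v x)"
    and A: "A \<in> sets borel"
  shows "(\<integral>\<^sup>+ v. emeasure (mvn (\<theta> + v *\<^sub>R a) \<Sigma>) A \<partial>L) =
         emeasure (density lborel (\<lambda>x. ennreal (mmn_density \<theta> a \<Sigma> L x))) A"
proof -
  interpret L: real_distribution L by fact
  interpret pair_sigma_finite L "lborel :: (real^'n) measure" ..
  have meas: "case_prod (\<lambda>v x. mvn_density (\<theta> + v *\<^sub>R a) \<Sigma> x) \<in> borel_measurable (L \<Otimes>\<^sub>M lborel)"
  proof -
    have "case_prod (\<lambda>v x. mvn_density (\<theta> + v *\<^sub>R a) \<Sigma> x) \<in> borel_measurable borel"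
      by (rule borel_measurable_continuous_onI) (rule continuous_mvn_density)
    moreover have "sets (L \<Otimes>\<^sub>M (lborel :: (real^'n) measure)) = sets (borel :: (real \<times> (real^'n)) measure)"
      unfolding borel_prod[symmetric] by (rule sets_pair_measure_cong) auto
    ultimately show ?thesis using measurable_cong_sets by blast
  qed
  have meas1 [measurable]: "(\<lambda>v. mvn_density (\<theta> + v *\<^sub>R a) \<Sigma> x) \<in> borel_measurable L" for x
    using measurable_compose[OF measurable_Pair2' meas, of x] by simp
  have meas2 [measurable]: "(\<lambda>x. mvn_density \<mu> \<Sigma> x) \<in> borel_measurable borel" for \<mu>
  proof -
    have "continuous_on UNIV (\<lambda>x. case (0, x) of (v, x) \<Rightarrow> mvn_density (\<mu> + v *\<^sub>R 0) \<Sigma> x)"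
      by (rule continuous_on_compose2[OF continuous_mvn_density]) (auto intro!: continuous_intros)
    then show ?thesis by (auto intro!: borel_measurable_continuous_onI)
  qed
  have det: "0 < det \<Sigma>" by (rule det_pos_of_positive_definite) (rule pd)
  have "invertible \<Sigma>" using det by (simp add: invertible_det_nz)
  then have inv: "\<Sigma> ** matrix_inv \<Sigma> = mat 1"
    unfolding invertible_def matrix_inv_def by (rule someI2_ex) auto
  have quad: "0 \<le> y \<bullet> (matrix_inv \<Sigma> *v y)" for y
  proof -
    define w where "w = matrix_inv \<Sigma> *v y"
    have y: "y = \<Sigma> *v w"
      unfolding w_def by (simp add: matrix_vector_mul_assoc inv)
    have "0 \<le> w \<bullet> (\<Sigma> *v w)" using pd[of w] by (cases "w = 0") auto
    then show ?thesis unfolding w_def[symmetric] using y by (simp add: inner_commute)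
  qed
  have pos: "0 \<le> mvn_density \<mu> \<Sigma> x" for \<mu> x
    unfolding mvn_density_def using det by simp
  have bound: "norm (mvn_density \<mu> \<Sigma> x) \<le> 1 / sqrt ((2 * pi) ^ CARD('n) * det \<Sigma>)" for \<mu> x
    using quad[of "x - \<mu>"] det pos[of \<mu> x]
    by (simp only: real_norm_def abs_of_nonneg) (auto simp: mvn_density_def intro!: divide_right_mono)
  have int: "integrable L (\<lambda>v. mvn_density (\<theta> + v *\<^sub>R a) \<Sigma> x)" for x
    using bound by (intro L.integrable_const_bound) auto
  have dens: "ennreal (mmn_density \<theta> a \<Sigma> L x) = (\<integral>\<^sup>+ v. ennreal (mvn_density (\<theta> + v *\<^sub>R a) \<Sigma> x) \<partial>L)" for x
    unfolding mmn_density_def by (rule nn_integral_eq_integral[symmetric, OF int]) (simp add: pos)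
  have meas3: "(\<lambda>x. ennreal (mmn_density \<theta> a \<Sigma> L x)) \<in> borel_measurable borel"
    unfolding dens
    using L.borel_measurable_nn_integral[of "\<lambda>x v. ennreal (mvn_density (\<theta> + v *\<^sub>R a) \<Sigma> x)" lborel]
      measurable_compose[OF measurable_pair_swap' meas] by (simp add: case_prod_beta)
  have meas4: "(\<lambda>(v, x). ennreal (mvn_density (\<theta> + v *\<^sub>R a) \<Sigma> x) * indicator A x) \<in> borel_measurable (L \<Otimes>\<^sub>M lborel)"
    using meas A by measurable
  have "(\<integral>\<^sup>+ v. emeasure (mvn (\<theta> + v *\<^sub>R a) \<Sigma>) A \<partial>L) =
        (\<integral>\<^sup>+ v. \<integral>\<^sup>+ x. ennreal (mvn_density (\<theta> + v *\<^sub>R a) \<Sigma> x) * indicator A x \<partial>lborel \<partial>L)"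
    using A by (simp add: mvn_def emeasure_density)
  also have "\<dots> = (\<integral>\<^sup>+ x. \<integral>\<^sup>+ v. ennreal (mvn_density (\<theta> + v *\<^sub>R a) \<Sigma> x) * indicator A x \<partial>L \<partial>lborel)"
    using Fubini'[OF meas4] by simp
  also have "\<dots> = (\<integral>\<^sup>+ x. ennreal (mmn_density \<theta> a \<Sigma> L x) * indicator A x \<partial>lborel)"
    by (simp add: dens nn_integral_multc)
  also have "\<dots> = emeasure (density lborel (\<lambda>x. ennreal (mmn_density \<theta> a \<Sigma> L x))) A"
    using A meas3 by (simp add: emeasure_density)
  finally show ?thesis .
qed

(* The integral of an extended-real function as positive minus negative part, so that divergent
   integrals have the value \<infinity> and not, as for the Bochner integral, 0. *)

definition ereal_integral :: "'a measure \<Rightarrow> ('a \<Rightarrow> ereal) \<Rightarrow> ereal" where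
  "ereal_integral M f =
     enn2ereal (\<integral>\<^sup>+ x. e2ennreal (f x) \<partial>M) - enn2ereal (\<integral>\<^sup>+ x. e2ennreal (- f x) \<partial>M)"

(* qhat x y is the predictive density at y after observing x; the model densities p \<theta> and q \<theta>
   come first in their arguments. All densities this is applied to are strictly positive, so the
   values of ln and of division at 0 play no role. *)

definition kl_risk ::
  "('t \<Rightarrow> 'x::euclidean_space \<Rightarrow> real) \<Rightarrow> ('t \<Rightarrow> 'y::euclidean_space \<Rightarrow> real) \<Rightarrow>
   't \<Rightarrow> ('x \<Rightarrow> 'y \<Rightarrow> real) \<Rightarrow> ereal" where
  "kl_risk p q \<theta> qhat =
     ereal_integral lborel (\<lambda>x.
       ereal_integral lborel (\<lambda>y. ereal (q \<theta> y * ln (q \<theta> y / qhat x y))) * ereal (p \<theta> x))"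

definition sq_risk :: "real^'m^'m \<Rightarrow> real^'m \<Rightarrow> (real^'m \<Rightarrow> real^'m) \<Rightarrow> ennreal" where
  "sq_risk \<Sigma> \<zeta> \<zeta>hat = (\<integral>\<^sup>+ z. ennreal ((norm (\<zeta>hat z - \<zeta>))\<^sup>2) \<partial>mvn \<zeta> \<Sigma>)"

definition dominates :: "('t \<Rightarrow> 'd \<Rightarrow> 'r::order) \<Rightarrow> 'd \<Rightarrow> 'd \<Rightarrow> bool" where
  "dominates R \<delta> \<delta>' \<longleftrightarrow> (\<forall>\<theta>. R \<theta> \<delta> \<le> R \<theta> \<delta>') \<and> (\<exists>\<theta>. R \<theta> \<delta> < R \<theta> \<delta>')"

definition diff_law :: "real measure \<Rightarrow> real measure \<Rightarrow> real measure" where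
  "diff_law L1 L2 = distr (L1 \<Otimes>\<^sub>M L2) borel (\<lambda>(v1, v2). v2 - v1)"

(* mat c is c times the identity matrix. *)

definition mre_density ::
  "real^'n \<Rightarrow> real \<Rightarrow> real measure \<Rightarrow> real^'n \<Rightarrow> real^'n \<Rightarrow> real" where
  "mre_density a s L x y = mmn_density x a (mat s) L y"

(* The one-dimensional MMN distribution lives on real^1; vec turns a scalar into such a vector. *)

definition split_density ::
  "real^'n \<Rightarrow> real \<Rightarrow> real measure \<Rightarrow> real^'n \<Rightarrow> real^'n^'m \<Rightarrow> (real^'m \<Rightarrow> real^'m) \<Rightarrow>
   real^'n \<Rightarrow> real^'n \<Rightarrow> real" where
  "split_density a s L h1 H2 \<zeta>hat x y =
     mmn_density (vec (h1 \<bullet> x) :: real^1) (vec (norm a)) (mat s) L (vec (h1 \<bullet> y)) *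
     mvn_density (\<zeta>hat (H2 *v x)) (mat s) (H2 *v y)"

end

theory Submission
  imports Defs
begin

text \<open>In coordinates along \<open>a\<close> and orthogonal to it, an isotropic normal mixture in the direction \<open>a\<close>
  is a product of a one-dimensional mixture along \<open>a\<close> and an isotropic Gaussian in the orthogonal
  complement (\<open>mix_axis_split\<close>). The equivariant predictive density at \<open>x\<close> and the split predictive
  density thus have the same factor along \<open>a\<close>, and the Gaussian factors differ only in their centres:
  \<open>H2 *v x\<close> for the former, \<open>\<zeta>hat (H2 *v x)\<close> for the latter. With \<open>s = \<sigma>X\<^sup>2 + \<sigma>Y\<^sup>2\<close>, the logarithm of the
  ratio of the two predictive densities at \<open>y\<close> is the difference of the squared distances of \<open>H2 *v y\<close>
  to these centres, divided by \<open>2 * s\<close>. Its mean under the true density is, by the bias-variance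
  decomposition, the difference of the squared errors of the two centres as estimates of \<open>H2 *v \<theta>\<close>,
  again divided by \<open>2 * s\<close>; the variance terms cancel (\<open>kl_div_recentre\<close>).

  Under the law of the observation, \<open>H2 *v x\<close> is Gaussian with mean \<open>H2 *v \<theta>\<close> and covariance \<open>\<sigma>X\<^sup>2 I\<close>.
  Integrating the identity gives (\<open>kl_risk_exchange\<close>)
  \<open>R(\<theta>) + S(\<zeta>, id) / (2 * s) = U + S(\<zeta>, \<zeta>hat) / (2 * s)\<close> with \<open>\<zeta> = H2 *v \<theta>\<close>,
  where \<open>R\<close> and \<open>U\<close> are the Kullback-Leibler risks of the split and of the equivariant density and \<open>S\<close>
  is the risk under squared error. By translation invariance \<open>U\<close> does not depend on \<open>\<theta>\<close>, so it is finite
  once it is finite somewhere; \<open>S(\<zeta>, id)\<close> is a finite second moment. Cancelling both, the order of \<open>R(\<theta>)\<close>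
  and \<open>U\<close> is that of \<open>S(\<zeta>, \<zeta>hat)\<close> and \<open>S(\<zeta>, id)\<close>, and every \<open>\<zeta>\<close> is of the form \<open>H2 *v \<theta>\<close>.

  The only analytic ingredient besides Gaussian integrals is that the change to the new coordinates
  preserves Lebesgue measure (\<open>nn_integral_lborel_isometry\<close>). All expectations are kept as integrals
  of nonnegative functions, and differences are written as equalities of sums, so that infinite
  divergences and infinite risks of \<open>\<zeta>hat\<close> are covered.\<close>

section \<open>Isotropic Gaussian densities\<close>

text \<open>The density of \<open>N(0, s I)\<close>; the parameter is the variance, not the standard deviation.\<close>

definition gauss :: "real \<Rightarrow> 'a::euclidean_space \<Rightarrow> real" where
  "gauss s x = exp (- (norm x)\<^sup>2 / (2 * s)) / sqrt ((2 * pi * s) ^ DIM('a))"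

lemma gauss_pos: "0 < s \<Longrightarrow> 0 < gauss s x"
  by (simp add: gauss_def)

lemma borel_measurable_gauss [measurable]: "gauss s \<in> borel_measurable borel"
  unfolding gauss_def by measurable

lemma gauss_le:
  fixes x :: "'a::euclidean_space"
  assumes "0 < s"
  shows "gauss s x \<le> 1 / sqrt ((2 * pi * s) ^ DIM('a))"
  using assms unfolding gauss_def by (intro divide_right_mono) (auto simp: divide_nonpos_pos)

lemma gauss_eq_prod_normal:
  fixes x :: "'a::euclidean_space"
  assumes "0 < s"
  shows "gauss s x = (\<Prod>b\<in>Basis. normal_density 0 (sqrt s) (x \<bullet> b))"
proof -
  have "(\<Prod>b\<in>Basis. normal_density 0 (sqrt s) (x \<bullet> b)) =
        exp (\<Sum>b\<in>Basis. - (x \<bullet> b)\<^sup>2 / (2 * s)) / sqrt (2 * pi * s) ^ DIM('a)"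
    using assms by (simp add: normal_density_def prod_dividef exp_sum)
  also have "(\<Sum>b\<in>Basis. - (x \<bullet> b)\<^sup>2 / (2 * s)) = - (norm x)\<^sup>2 / (2 * s)"
    unfolding power2_norm_eq_inner euclidean_inner[of x x]
    by (simp add: sum_negf sum_divide_distrib power2_eq_square)
  finally show ?thesis by (simp add: gauss_def real_sqrt_power)
qed

lemma nn_integral_gauss:
  assumes "0 < s"
  shows "(\<integral>\<^sup>+ x. ennreal (gauss s x) \<partial>(lborel :: 'a::euclidean_space measure)) = 1"
proof -
  have "(\<integral>\<^sup>+ t. ennreal (normal_density 0 (sqrt s) t) \<partial>lborel) = 1"
    using prob_space.emeasure_space_1[OF prob_space_normal_density[of "sqrt s" 0]] assms
    by (simp add: emeasure_density)
  then have "(\<integral>\<^sup>+ x. (\<Prod>b\<in>Basis. ennreal (normal_density 0 (sqrt s) (x \<bullet> b)))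
      \<partial>(lborel :: 'a measure)) = 1"
    by (subst nn_integral_lborel_prod) auto
  then show ?thesis
    using assms by (simp add: gauss_eq_prod_normal prod_ennreal normal_density_nonneg)
qed

section \<open>Lebesgue measure under linear isometries\<close>

lemma nn_integral_lborel_shift:
  fixes f :: "'a::euclidean_space \<Rightarrow> ennreal"
  assumes [measurable]: "f \<in> borel_measurable borel"
  shows "(\<integral>\<^sup>+ x. f (c + x) \<partial>lborel) = (\<integral>\<^sup>+ x. f x \<partial>lborel)"
proof -
  have "(\<integral>\<^sup>+ x. f x \<partial>lborel) = (\<integral>\<^sup>+ x. f x \<partial>distr lborel borel ((+) c))"
    by (simp add: lborel_distr_plus)
  then show ?thesis by (simp add: nn_integral_distr)
qed

text \<open>Averaging against a Gaussian shows the invariance. Write \<open>g \<circ> T\<close> as its integral against a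
  Gaussian of mass one in an extra variable \<open>y\<close> centred at \<open>T x\<close>, exchange the integrals, and
  translate \<open>x\<close> by a preimage of \<open>y\<close> (this uses surjectivity): the Gaussian factor then depends on
  \<open>T x\<close> only, hence on \<open>norm x\<close> only, and the remaining \<open>y\<close>-integral is a translate of the integral
  of \<open>g\<close>. Equal dimensions make the normalising constants of the two Gaussians agree. Taking domain
  and codomain to be different types allows \<open>T\<close> to map into a product space.\<close>

lemma nn_integral_lborel_isometry:
  fixes T :: "'a::euclidean_space \<Rightarrow> 'b::euclidean_space" and g :: "'b \<Rightarrow> ennreal"
  assumes T: "linear T" and iso: "\<And>x. norm (T x) = norm x" and surj: "surj T"
    and dim: "DIM('a) = DIM('b)"
    and [measurable]: "g \<in> borel_measurable borel"
  shows "(\<integral>\<^sup>+ x. g (T x) \<partial>lborel) = (\<integral>\<^sup>+ y. g y \<partial>lborel)"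
proof -
  let ?f = "\<lambda>y::'b. ennreal (gauss 1 y)"
  have [measurable]: "T \<in> borel_measurable borel"
    using T by (intro borel_measurable_continuous_onI linear_continuous_on)
      (simp add: linear_conv_bounded_linear)
  have gT: "gauss 1 (T x) = gauss 1 x" for x
    by (simp add: gauss_def iso dim)
  have sym: "gauss 1 (y - z) = gauss 1 (z - y)" for y z :: 'b
    by (simp add: gauss_def norm_minus_commute)
  have "(\<integral>\<^sup>+ x. g (T x) \<partial>lborel) = (\<integral>\<^sup>+ x. (\<integral>\<^sup>+ y. g (T x) * ?f (- T x + y) \<partial>lborel) \<partial>lborel)"
    using nn_integral_lborel_shift[of ?f] nn_integral_gauss[of 1, where 'a='b]
    by (simp add: nn_integral_cmult del: add_uminus_conv_diff uminus_add_conv_diff)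
  also have "\<dots> = (\<integral>\<^sup>+ y. (\<integral>\<^sup>+ x. g (T x) * ?f (- T x + y) \<partial>lborel) \<partial>lborel)"
    by (rule lborel_pair.Fubini'[symmetric]) measurable
  also have "\<dots> = (\<integral>\<^sup>+ y. (\<integral>\<^sup>+ x. g (y + T x) * ?f (T x) \<partial>lborel) \<partial>lborel)"
  proof (rule nn_integral_cong)
    fix y
    obtain z where z: "y = T z" using surj by auto
    have "(\<integral>\<^sup>+ x. g (T (z + x)) * ?f (- T (z + x) + y) \<partial>lborel) =
          (\<integral>\<^sup>+ x. g (T x) * ?f (- T x + y) \<partial>lborel)"
      by (rule nn_integral_lborel_shift) measurable
    then show "(\<integral>\<^sup>+ x. g (T x) * ?f (- T x + y) \<partial>lborel) = (\<integral>\<^sup>+ x. g (y + T x) * ?f (T x) \<partial>lborel)"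
      using sym[of 0] by (simp add: z linear_add[OF T])
  qed
  also have "\<dots> = (\<integral>\<^sup>+ x. (\<integral>\<^sup>+ y. g (y + T x) * ?f (T x) \<partial>lborel) \<partial>lborel)"
    by (rule lborel_pair.Fubini') measurable
  also have "\<dots> = (\<integral>\<^sup>+ x. (\<integral>\<^sup>+ y. g y \<partial>lborel) * ?f (T x) \<partial>lborel)"
    by (simp add: nn_integral_multc nn_integral_lborel_shift[where f=g] add.commute[of _ "T _"])
  also have "\<dots> = (\<integral>\<^sup>+ y. g y \<partial>lborel)"
    by (simp add: gT nn_integral_cmult nn_integral_gauss)
  finally show ?thesis .
qed

section \<open>Second moments\<close>

definition gauss_moment2 :: "'a::euclidean_space itself \<Rightarrow> real \<Rightarrow> ennreal" where
  "gauss_moment2 _ s = (\<integral>\<^sup>+ x. ennreal ((norm (x::'a))\<^sup>2 * gauss s x) \<partial>lborel)"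

text \<open>The bound \<open>u \<le> exp u\<close> at \<open>u = (norm x)\<^sup>2 / (4 * s)\<close> absorbs the factor \<open>(norm x)\<^sup>2\<close> into a
  Gaussian of doubled variance.\<close>

lemma gauss_moment2_finite:
  assumes s: "0 < s"
  shows "gauss_moment2 TYPE('a::euclidean_space) s < \<infinity>"
proof -
  \<comment> \<open>the square root is the quotient of the normalising constants for \<open>2 * s\<close> and \<open>s\<close>\<close>
  define K where "K = 4 * s * sqrt (2 ^ DIM('a))"
  have "(norm x)\<^sup>2 * gauss s x \<le> K * gauss (2 * s) x" for x :: 'a
  proof -
    let ?u = "(norm x)\<^sup>2 / (4 * s)"
    have "?u \<le> exp ?u" using exp_ge_add_one_self[of ?u] by linarith
    then have "(norm x)\<^sup>2 \<le> 4 * s * exp ?u" using s by (simp add: field_simps)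
    then have "(norm x)\<^sup>2 * exp (- (norm x)\<^sup>2 / (2 * s)) \<le> 4 * s * exp ?u * exp (- (norm x)\<^sup>2 / (2 * s))"
      by (rule mult_right_mono) simp
    also have "\<dots> = 4 * s * exp (- (norm x)\<^sup>2 / (2 * (2 * s)))"
      unfolding mult.assoc exp_add[symmetric] using s by (simp add: field_simps)
    finally have "(norm x)\<^sup>2 * exp (- (norm x)\<^sup>2 / (2 * s)) / sqrt ((2 * pi * s) ^ DIM('a)) \<le>
        4 * s * exp (- (norm x)\<^sup>2 / (2 * (2 * s))) / sqrt ((2 * pi * s) ^ DIM('a))"
      using s by (intro divide_right_mono) auto
    moreover have "sqrt ((2 * pi * (2 * s)) ^ DIM('a)) = sqrt (2 ^ DIM('a)) * sqrt ((2 * pi * s) ^ DIM('a))"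
      by (simp only: real_sqrt_mult[symmetric] power_mult_distrib[symmetric]) (simp add: mult_ac)
    ultimately show ?thesis
      unfolding gauss_def K_def by simp
  qed
  then have "gauss_moment2 TYPE('a) s \<le> (\<integral>\<^sup>+ x. ennreal K * ennreal (gauss (2 * s) (x::'a)) \<partial>lborel)"
    unfolding gauss_moment2_def using s
    by (intro nn_integral_mono) (simp add: ennreal_mult[symmetric] K_def less_imp_le gauss_pos)
  also have "\<dots> = ennreal K"
    using s by (simp add: nn_integral_cmult nn_integral_gauss)
  finally show ?thesis by (simp add: le_less_trans)
qed

text \<open>The bias-variance decomposition. Averaging the integrand over the reflection about \<open>\<theta>\<close> turns
  the vanishing of the cross term into the parallelogram identity, so that all integrals are of
  nonnegative functions and no integrability has to be checked.\<close>

lemma nn_integral_gauss_sqdist: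
  fixes \<zeta> \<theta> :: "'a::euclidean_space"
  assumes s: "0 < s"
  shows "(\<integral>\<^sup>+ z. ennreal ((norm (z - \<zeta>))\<^sup>2 * gauss s (z - \<theta>)) \<partial>lborel) =
         gauss_moment2 TYPE('a) s + ennreal ((norm (\<theta> - \<zeta>))\<^sup>2)"
proof -
  let ?g = "\<lambda>d x::'a. ennreal ((norm (x + d))\<^sup>2 * gauss s x)"
  define d where "d = \<theta> - \<zeta>"
  have shift: "(\<integral>\<^sup>+ z. ennreal ((norm (z - \<zeta>))\<^sup>2 * gauss s (z - \<theta>)) \<partial>lborel) = (\<integral>\<^sup>+ x. ?g d x \<partial>lborel)"
    by (subst nn_integral_lborel_shift[of _ \<theta>, symmetric]) (auto simp: d_def algebra_simps)
  have refl: "(\<integral>\<^sup>+ x. ?g d (- x) \<partial>lborel) = (\<integral>\<^sup>+ x. ?g d x \<partial>lborel)"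
    by (rule nn_integral_lborel_isometry) (auto intro: linear_uminus simp: surj_def) 
  have "2 * (\<integral>\<^sup>+ x. ?g d x \<partial>lborel) = (\<integral>\<^sup>+ x. ?g d x + ?g d (- x) \<partial>lborel)"
    by (subst nn_integral_add) (auto simp: refl mult_2 simp del: minus_add_distrib uminus_add_conv_diff)
  also have "\<dots> = (\<integral>\<^sup>+ x. 2 * (ennreal ((norm (x::'a))\<^sup>2 * gauss s x) + ennreal ((norm d)\<^sup>2) * ennreal (gauss s x)) \<partial>lborel)"
  proof (rule nn_integral_cong)
    fix x :: 'a
    have "(norm (x + d))\<^sup>2 + (norm (- x + d))\<^sup>2 = 2 * (norm x)\<^sup>2 + 2 * (norm d)\<^sup>2"
      by (simp add: power2_norm_eq_inner inner_simps inner_commute)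
    then have "(norm (x + d))\<^sup>2 * gauss s x + (norm (- x + d))\<^sup>2 * gauss s x =
      2 * ((norm x)\<^sup>2 * gauss s x + (norm d)\<^sup>2 * gauss s x)"
      by (simp add: distrib_right[symmetric] distrib_left)
    moreover have "gauss s (- x) = gauss s x" by (simp add: gauss_def)
    ultimately show "?g d x + ?g d (- x) =
        2 * (ennreal ((norm x)\<^sup>2 * gauss s x) + ennreal ((norm d)\<^sup>2) * ennreal (gauss s x))"
      using gauss_pos[OF s, of x] 
      by (simp add: ennreal_plus[symmetric] ennreal_mult[symmetric] ennreal_numeral[symmetric]
          del: ennreal_plus ennreal_numeral)
  qed
  also have "\<dots> = 2 * (gauss_moment2 TYPE('a) s + ennreal ((norm d)\<^sup>2))"
    by (simp add: nn_integral_cmult nn_integral_add nn_integral_gauss s gauss_moment2_def)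
  finally have "(\<integral>\<^sup>+ x. ?g d x \<partial>lborel) = gauss_moment2 TYPE('a) s + ennreal ((norm d)\<^sup>2)"
    unfolding ennreal_mult_cancel_left by simp
  then show ?thesis
    by (simp only: shift d_def)
qed

section \<open>Mixtures of isotropic Gaussians along a direction\<close>

lemma mat_vector_mult: "mat c *v x = c *\<^sub>R (x :: real^'n)"
  by (simp add: vec_eq_iff matrix_vector_mult_def mat_def if_distrib if_distribR cong: if_cong)

lemma matrix_inv_mat:
  assumes "c \<noteq> 0"
  shows "matrix_inv (mat c :: real^'n^'n) = mat (1 / c)"
proof -
  have *: "mat c ** mat (1 / c) = (mat 1 :: real^'n^'n)" "mat (1 / c) ** mat c = (mat 1 :: real^'n^'n)"
    using assms by (simp_all add: matrix_eq mat_vector_mult flip: matrix_vector_mul_assoc)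
  have "B = mat (1 / c)" if B: "mat c ** B = mat 1 \<and> B ** mat c = mat 1" for B :: "real^'n^'n"
  proof -
    have "B = B ** (mat c ** mat (1 / c))" by (simp add: * matrix_mul_rid)
    also have "\<dots> = mat (1 / c)" using B by (simp add: matrix_mul_assoc matrix_mul_lid)
    finally show ?thesis .
  qed
  then show ?thesis
    unfolding matrix_inv_def by (rule some_equality[rotated]) (auto intro: *)
qed

lemma mvn_density_mat:
  fixes x :: "real^'n"
  assumes "0 < s"
  shows "mvn_density \<mu> (mat s) x = gauss s (x - \<mu>)"
proof -
  have "det (mat s :: real^'n^'n) = s ^ CARD('n)"
    by (subst det_diagonal) (auto simp: mat_def)
  then show ?thesis
    using assms unfolding mvn_density_def gauss_def
    by (simp add: matrix_inv_mat mat_vector_mult power_mult_distrib power2_norm_eq_inner mult.commute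
        del: scaleR_right_diff_distrib)
qed

text \<open>Over a general Euclidean space, so that the same function serves on \<open>real^'n\<close> and, for the
  marginal along the direction of the shift, on \<open>real\<close>.\<close>

definition mix :: "real \<Rightarrow> 'a::euclidean_space \<Rightarrow> real measure \<Rightarrow> 'a \<Rightarrow> real" where
  "mix s a L x = (\<integral>v. gauss s (x - v *\<^sub>R a) \<partial>L)"

lemma mmn_density_mat: "0 < s \<Longrightarrow> mmn_density \<theta> a (mat s) L x = mix s a L (x - \<theta>)"
  by (simp add: mmn_density_def mix_def mvn_density_mat algebra_simps)

context real_distribution
begin

lemma borel_measurable_mix [measurable]: "mix s a M \<in> borel_measurable borel"
  unfolding mix_def by measurable

lemma integrable_gauss_shift:
  assumes "0 < s"
  shows "integrable M (\<lambda>v. gauss s (x - v *\<^sub>R a))"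
proof (rule integrable_const_bound)
  show "AE v in M. norm (gauss s (x - v *\<^sub>R a)) \<le> 1 / sqrt ((2 * pi * s) ^ DIM('a))"
    using gauss_le[OF assms, where 'a='a] gauss_pos[OF assms, where 'a='a] by (simp add: less_imp_le)
qed measurable

lemma mix_pos:
  assumes s: "0 < s"
  shows "0 < mix s a M x"
proof -
  have "mix s a M x \<noteq> 0"
  proof
    assume "mix s a M x = 0"
    then have "AE v in M. gauss s (x - v *\<^sub>R a) = 0"
      unfolding mix_def
      by (subst (asm) integral_nonneg_eq_0_iff_AE)
        (auto simp: integrable_gauss_shift s gauss_pos less_imp_le)
    then have "AE v in M. False"
      by eventually_elim (use gauss_pos[OF s] less_irrefl in metis)
    then show False by simp
  qed
  moreover have "0 \<le> mix s a M x"
    unfolding mix_def by (simp add: gauss_pos s less_imp_le)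
  ultimately show ?thesis by simp
qed

lemma nn_integral_mix:
  assumes s: "0 < s"
  shows "(\<integral>\<^sup>+ x. ennreal (mix s a M (x - \<theta>)) \<partial>lborel) = 1"
proof -
  interpret pair_sigma_finite M "lborel :: 'a measure" ..
  have shift: "(\<integral>\<^sup>+ x. ennreal (gauss s (x - c)) \<partial>lborel) = 1" for c :: 'a
    using nn_integral_lborel_shift[of "\<lambda>x. ennreal (gauss s x)" "- c"] nn_integral_gauss[OF s, where 'a='a]
    by simp
  have "(\<integral>\<^sup>+ x. ennreal (mix s a M (x - \<theta>)) \<partial>lborel) =
        (\<integral>\<^sup>+ x. \<integral>\<^sup>+ v. ennreal (gauss s (x - (\<theta> + v *\<^sub>R a))) \<partial>M \<partial>lborel)"
    unfolding mix_def diff_diff_eq[symmetric]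
    by (intro nn_integral_cong nn_integral_eq_integral[symmetric] integrable_gauss_shift)
      (auto simp: gauss_pos s less_imp_le)
  also have "\<dots> = (\<integral>\<^sup>+ v. \<integral>\<^sup>+ x. ennreal (gauss s (x - (\<theta> + v *\<^sub>R a))) \<partial>lborel \<partial>M)"
    by (rule Fubini') measurable
  also have "\<dots> = 1"
    by (simp add: shift emeasure_space_1[simplified])
  finally show ?thesis .
qed

end

lemma real_distribution_diff_law:
  assumes "real_distribution L1" "real_distribution L2"
  shows "real_distribution (diff_law L1 L2)"
proof -
  interpret L1: real_distribution L1 by fact
  interpret L2: real_distribution L2 by fact
  interpret pair_prob_space L1 L2 ..
  show ?thesis
    unfolding diff_law_def real_distribution_def real_distribution_axioms_def
    by (auto intro!: prob_space_distr)
qed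

section \<open>Kullback-Leibler divergence as a nonnegative integral\<close>

text \<open>The Bregman form: for probability densities the terms \<open>- f + g\<close> integrate to zero, and they
  make the integrand nonnegative. The divergence is then an \<open>ennreal\<close> without any integrability
  assumption, and infinite values need no separate treatment.\<close>

definition kl_div :: "('a::euclidean_space \<Rightarrow> real) \<Rightarrow> ('a \<Rightarrow> real) \<Rightarrow> ennreal" where
  "kl_div f g = (\<integral>\<^sup>+ y. ennreal (f y * ln (f y / g y) - f y + g y) \<partial>lborel)"

lemma log_ratio_ge:
  fixes u v :: real
  assumes "0 < u" "0 < v"
  shows "u - v \<le> u * ln (u / v)"
proof -
  have "ln (v / u) \<le> v / u - 1" using assms by (intro ln_le_minus_one) simp
  then have "u * ln (v / u) \<le> u * (v / u - 1)" using assms by (intro mult_left_mono) auto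
  also have "\<dots> = v - u" using assms by (simp add: field_simps)
  finally show ?thesis using assms by (simp add: ln_div algebra_simps)
qed

text \<open>The negative part of \<open>f * ln (f / g)\<close> is at most \<open>g\<close> and so has a finite integral, which makes
  the difference of the two parts well defined.\<close>

lemma ereal_integral_log_ratio:
  fixes f g :: "'a::euclidean_space \<Rightarrow> real"
  assumes [measurable]: "f \<in> borel_measurable borel" "g \<in> borel_measurable borel"
    and pos: "\<And>y. 0 < f y" "\<And>y. 0 < g y"
    and f1: "(\<integral>\<^sup>+ y. ennreal (f y) \<partial>lborel) = 1" and g1: "(\<integral>\<^sup>+ y. ennreal (g y) \<partial>lborel) = 1"
  shows "ereal_integral lborel (\<lambda>y. ereal (f y * ln (f y / g y))) = enn2ereal (kl_div f g)"
proof -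
  define h where "h y = f y * ln (f y / g y)" for y
  have [measurable]: "h \<in> borel_measurable borel" unfolding h_def by measurable
  have h: "f y - g y \<le> h y" for y unfolding h_def using pos by (rule log_ratio_ge)
  define P where "P = (\<integral>\<^sup>+ y. ennreal (h y) \<partial>lborel)"
  define N where "N = (\<integral>\<^sup>+ y. ennreal (- h y) \<partial>lborel)"
  have "N \<le> (\<integral>\<^sup>+ y. ennreal (g y) \<partial>lborel)"
    unfolding N_def using h pos by (intro nn_integral_mono ennreal_leI) (smt (verit))
  then have N: "N \<noteq> \<infinity>" using g1 by (auto simp: top_unique)
  have "P + 1 = (\<integral>\<^sup>+ y. ennreal (h y) + ennreal (g y) \<partial>lborel)"
    unfolding P_def g1[symmetric] by (rule nn_integral_add[symmetric]) measurable
  also have "\<dots> = (\<integral>\<^sup>+ y. ennreal (h y - f y + g y) + ennreal (- h y) + ennreal (f y) \<partial>lborel)"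
  proof (rule nn_integral_cong)
    fix y show "ennreal (h y) + ennreal (g y) = ennreal (h y - f y + g y) + ennreal (- h y) + ennreal (f y)"
      using h[of y] pos(1)[of y] pos(2)[of y]
      by (cases "0 \<le> h y") (auto simp: ennreal_plus[symmetric] ennreal_neg simp del: ennreal_plus)
  qed
  also have "\<dots> = kl_div f g + N + 1"
    unfolding kl_div_def N_def f1[symmetric] h_def[symmetric] by (simp add: nn_integral_add)
  finally have "P = kl_div f g + N"
    by (metis add.commute ennreal_add_left_cancel ennreal_one_neq_top infinity_ennreal_def)
  then have "enn2ereal P - enn2ereal N = enn2ereal (kl_div f g)"
    using N by (cases N; cases "kl_div f g") (auto simp: plus_ennreal.rep_eq)
  then show ?thesis
    by (simp add: ereal_integral_def P_def N_def h_def)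
qed

text \<open>Subtracting two divergences with the same \<open>f\<close> leaves the integral of \<open>f * ln (g / g')\<close>. The terms
  are arranged on two sides of an equation so that the identity also holds when some of them are
  infinite.\<close>

lemma kl_div_change_reference:
  fixes f g g' D D' :: "'a::euclidean_space \<Rightarrow> real"
  assumes [measurable]: "f \<in> borel_measurable borel" "g \<in> borel_measurable borel"
      "g' \<in> borel_measurable borel" "D \<in> borel_measurable borel" "D' \<in> borel_measurable borel"
    and pos: "\<And>y. 0 < f y" "\<And>y. 0 < g y" "\<And>y. 0 < g' y"
    and D: "\<And>y. 0 \<le> D y" "\<And>y. 0 \<le> D' y"
    and g1: "(\<integral>\<^sup>+ y. ennreal (g y) \<partial>lborel) = 1" and g'1: "(\<integral>\<^sup>+ y. ennreal (g' y) \<partial>lborel) = 1"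
    and ratio: "\<And>y. g' y = g y * exp (D y - D' y)"
  shows "kl_div f g' + (\<integral>\<^sup>+ y. ennreal (D y) * ennreal (f y) \<partial>lborel) =
         kl_div f g + (\<integral>\<^sup>+ y. ennreal (D' y) * ennreal (f y) \<partial>lborel)"
proof -
  have eq: "ennreal (f y * ln (f y / g' y) - f y + g' y) + ennreal (D y) * ennreal (f y) + ennreal (g y) =
      ennreal (f y * ln (f y / g y) - f y + g y) + ennreal (D' y) * ennreal (f y) + ennreal (g' y)" for y
  proof -
    have "ln (f y / g' y) = ln (f y / g y) + D' y - D y"
      using pos(1)[of y] pos(2)[of y] by (simp add: ratio ln_div ln_mult)
    then have "f y * ln (f y / g' y) - f y + g' y + D y * f y + g y =
       f y * ln (f y / g y) - f y + g y + D' y * f y + g' y"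
      by (simp only:) (simp add: algebra_simps)
    then show ?thesis
      using log_ratio_ge[OF pos(1,2), of y y] log_ratio_ge[OF pos(1,3), of y y] pos[of y] D[of y]
      by (simp add: ennreal_plus[symmetric] ennreal_mult[symmetric] del: ennreal_plus)
  qed
  have "kl_div f g' + (\<integral>\<^sup>+ y. ennreal (D y) * ennreal (f y) \<partial>lborel) + 1 =
    (\<integral>\<^sup>+ y. ennreal (f y * ln (f y / g' y) - f y + g' y) + ennreal (D y) * ennreal (f y) + ennreal (g y) \<partial>lborel)"
    unfolding kl_div_def g1[symmetric] by (simp add: nn_integral_add)
  also have "\<dots> = kl_div f g + (\<integral>\<^sup>+ y. ennreal (D' y) * ennreal (f y) \<partial>lborel) + 1"
    unfolding eq kl_div_def g'1[symmetric] by (simp add: nn_integral_add)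
  finally show ?thesis
    by (metis add.commute ennreal_add_left_cancel ennreal_one_neq_top infinity_ennreal_def)
qed

text \<open>All inner divergences are nonnegative, so the outer extended integral has no negative part.\<close>

lemma kl_risk_eq_nn_integral:
  assumes "p \<theta> \<in> borel_measurable borel" "q \<theta> \<in> borel_measurable borel"
    "\<And>x. qhat x \<in> borel_measurable borel"
    and pos: "\<And>x. 0 < p \<theta> x" "\<And>y. 0 < q \<theta> y" "\<And>x y. 0 < qhat x y"
    and "(\<integral>\<^sup>+ y. ennreal (q \<theta> y) \<partial>lborel) = 1" "\<And>x. (\<integral>\<^sup>+ y. ennreal (qhat x y) \<partial>lborel) = 1"
  shows "kl_risk p q \<theta> qhat =
         enn2ereal (\<integral>\<^sup>+ x. kl_div (q \<theta>) (qhat x) * ennreal (p \<theta> x) \<partial>lborel)"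
proof -
  have scale: "enn2ereal K * ereal (p \<theta> x) = enn2ereal (K * ennreal (p \<theta> x))" for K x
    using pos(1)[of x] by (simp add: times_ennreal.rep_eq)
  have "kl_risk p q \<theta> qhat =
      ereal_integral lborel (\<lambda>x. enn2ereal (kl_div (q \<theta>) (qhat x) * ennreal (p \<theta> x)))"
    unfolding kl_risk_def using assms by (simp only: ereal_integral_log_ratio scale)
  then show ?thesis
    by (simp add: ereal_integral_def e2ennreal_neg zero_ennreal.rep_eq)
qed

section \<open>Splitting off the axis of the mixture\<close>

lemma borel_measurable_matrix_vector_mult [measurable]:
  fixes A :: "real^'n^'m"
  assumes "f \<in> borel_measurable M"
  shows "(\<lambda>x. A *v f x) \<in> borel_measurable M"
proof -
  have "(\<lambda>x. A *v x) \<in> borel_measurable borel"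
    by (intro borel_measurable_continuous_onI linear_continuous_on)
      (simp add: matrix_vector_mul_bounded_linear)
  then show ?thesis using measurable_compose[OF assms] by blast
qed

text \<open>The map \<open>x \<mapsto> (e \<bullet> x, B *v x)\<close> is an isometry onto \<open>real \<times> real^'m\<close>, and \<open>(t, w) \<mapsto> t *\<^sub>R e + w v* B\<close>
  is its inverse, so these are coordinates in an orthonormal frame whose first vector is \<open>e\<close>.\<close>

locale axis_split =
  fixes e :: "real^'n" and B :: "real^'n^'m"
  assumes norm_split: "(norm x)\<^sup>2 = (e \<bullet> x)\<^sup>2 + (norm (B *v x))\<^sup>2"
    and axis_coord: "e \<bullet> (t *\<^sub>R e + w v* B) = t"
    and complement_coord: "B *v (t *\<^sub>R e + w v* B) = w"
    and dim: "CARD('n) = 1 + CARD('m)"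
begin

lemma axis_unit: "e \<bullet> e = 1" and complement_axis: "B *v e = 0"
  using axis_coord[of 1 0] complement_coord[of 1 0] by simp_all

lemma nn_integral_axis_split:
  assumes [measurable]: "u \<in> borel_measurable borel" "w \<in> borel_measurable borel"
  shows "(\<integral>\<^sup>+ x. u (e \<bullet> x) * w (B *v x) \<partial>lborel) =
         (\<integral>\<^sup>+ t. u t \<partial>lborel) * (\<integral>\<^sup>+ z. w z \<partial>lborel)"
proof -
  let ?T = "\<lambda>x. (e \<bullet> x, B *v x)"
  have "(\<integral>\<^sup>+ x. (case ?T x of (t, z) \<Rightarrow> u t * w z) \<partial>lborel) =
        (\<integral>\<^sup>+ p. (case p of (t, z) \<Rightarrow> u t * w z) \<partial>(lborel :: (real \<times> (real^'m)) measure))"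
  proof (rule nn_integral_lborel_isometry)
    show "linear ?T"
      by (rule linearI) (simp_all add: inner_add_right matrix_vector_right_distrib matrix_vector_mult_scaleR)
    show "norm (?T x) = norm x" for x
      using norm_split[of x] by (simp add: norm_Pair) (metis norm_ge_zero real_sqrt_unique)
    have "\<exists>x. ?T x = (t, z)" for t z
      using axis_coord[of t z] complement_coord[of t z] by blast
    then show "surj ?T" unfolding surj_def by (metis surj_pair)
    show "DIM(real^'n) = DIM(real \<times> (real^'m))" by (simp add: dim)
    show "(\<lambda>(t, z). u t * w z) \<in> borel_measurable (borel :: (real \<times> (real^'m)) measure)"
      unfolding borel_prod[symmetric] by measurable
  qed
  also have "\<dots> = (\<integral>\<^sup>+ p. (case p of (t, z) \<Rightarrow> u t * w z) \<partial>((lborel :: real measure) \<Otimes>\<^sub>M (lborel :: (real^'m) measure)))"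
    by (simp add: lborel_prod)
  also have "\<dots> = (\<integral>\<^sup>+ t. \<integral>\<^sup>+ z. u t * w z \<partial>lborel \<partial>lborel)"
    by (subst lborel.nn_integral_fst[symmetric]) auto
  also have "\<dots> = (\<integral>\<^sup>+ t. u t \<partial>lborel) * (\<integral>\<^sup>+ z. w z \<partial>lborel)"
    by (simp add: nn_integral_cmult nn_integral_multc)
  finally show ?thesis by simp
qed

text \<open>Pythagoras in the exponent; the dimensions add up in the normalising constant.\<close>

lemma gauss_axis_split:
  assumes "0 < s"
  shows "gauss s x = gauss s (e \<bullet> x) * gauss s (B *v x)"
proof -
  have "exp (- (norm x)\<^sup>2 / (2 * s)) =
      exp (- (norm (e \<bullet> x))\<^sup>2 / (2 * s)) * exp (- (norm (B *v x))\<^sup>2 / (2 * s))"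
    using assms by (simp only: exp_add[symmetric] norm_split[of x]) (simp add: field_simps)
  then show ?thesis
    by (simp add: gauss_def dim real_sqrt_mult)
qed

text \<open>The shift \<open>v *\<^sub>R r *\<^sub>R e\<close> moves only the coordinate along \<open>e\<close>, so the factor in the complement
  does not depend on \<open>v\<close> and leaves the integral.\<close>

lemma mix_axis_split:
  assumes "0 < s"
  shows "mix s (r *\<^sub>R e) L x = mix s r L (e \<bullet> x) * gauss s (B *v x)"
proof -
  have "e \<bullet> (x - v *\<^sub>R r *\<^sub>R e) = e \<bullet> x - v *\<^sub>R r" for v
    by (simp add: inner_diff_right axis_unit)
  moreover have "B *v (x - v *\<^sub>R r *\<^sub>R e) = B *v x" for v
    by (simp add: matrix_vector_mult_diff_distrib matrix_vector_mult_scaleR complement_axis)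
  ultimately show ?thesis
    unfolding mix_def gauss_axis_split[OF assms, of "x - _"] by simp
qed

text \<open>The mixing law enters only the factor along \<open>e\<close>, which integrates to one, so the marginal in
  the complement is the Gaussian \<open>N(B *v \<theta>, s I)\<close>.\<close>

lemma nn_integral_mix_complement:
  assumes L: "real_distribution L" and s: "0 < s" and [measurable]: "\<phi> \<in> borel_measurable borel"
  shows "(\<integral>\<^sup>+ x. \<phi> (B *v x) * ennreal (mix s (r *\<^sub>R e) L (x - \<theta>)) \<partial>lborel) =
         (\<integral>\<^sup>+ z. \<phi> z * ennreal (gauss s (z - B *v \<theta>)) \<partial>lborel)"
proof -
  interpret L: real_distribution L by fact
  have mass: "(\<integral>\<^sup>+ t. ennreal (mix s r L t) \<partial>lborel) = 1"
    using L.nn_integral_mix[OF s, of r 0] by simp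
  have "(\<integral>\<^sup>+ x. \<phi> (B *v x) * ennreal (mix s (r *\<^sub>R e) L (x - \<theta>)) \<partial>lborel) =
        (\<integral>\<^sup>+ x. \<phi> (B *v (\<theta> + x)) * ennreal (mix s (r *\<^sub>R e) L x) \<partial>lborel)"
    by (subst nn_integral_lborel_shift[of _ \<theta>, symmetric]) simp_all
  also have "\<dots> = (\<integral>\<^sup>+ x. ennreal (mix s r L (e \<bullet> x)) *
      (\<phi> (B *v \<theta> + B *v x) * ennreal (gauss s (B *v x))) \<partial>lborel)"
    by (simp add: mix_axis_split s matrix_vector_right_distrib ennreal_mult L.mix_pos gauss_pos
        less_imp_le mult_ac)
  also have "\<dots> = (\<integral>\<^sup>+ z. \<phi> (B *v \<theta> + z) * ennreal (gauss s z) \<partial>lborel)"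
    by (subst nn_integral_axis_split) (simp_all add: mass)
  also have "\<dots> = (\<integral>\<^sup>+ z. \<phi> z * ennreal (gauss s (z - B *v \<theta>)) \<partial>lborel)"
    by (subst (2) nn_integral_lborel_shift[of _ "B *v \<theta>", symmetric]) simp_all
  finally show ?thesis .
qed

text \<open>Moving the centre of the predictive density from \<open>c\<close> to \<open>c'\<close> within the
  complement of the axis changes only the Gaussian factor, so the log ratio of the two predictive
  densities is a difference of squared distances in the complement, divided by \<open>2 * s\<close>. Its mean
  under the true density is given by the bias-variance decomposition; the variance contribution is
  the same on both sides and, being finite, cancels.\<close>

lemma kl_div_recentre:
  assumes L: "real_distribution L" and L': "real_distribution L'"
    and t: "0 < t" and s: "0 < s"
    and c: "e \<bullet> c' = e \<bullet> c"
  shows "kl_div (\<lambda>y. mix t (r *\<^sub>R e) L (y - \<theta>)) (\<lambda>y. mix s (r *\<^sub>R e) L' (y - c')) +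
           ennreal (1 / (2 * s)) * ennreal ((norm (B *v c - B *v \<theta>))\<^sup>2) =
         kl_div (\<lambda>y. mix t (r *\<^sub>R e) L (y - \<theta>)) (\<lambda>y. mix s (r *\<^sub>R e) L' (y - c)) +
           ennreal (1 / (2 * s)) * ennreal ((norm (B *v c' - B *v \<theta>))\<^sup>2)"
    (is "?K c' + ?k * ?n c = ?K c + ?k * ?n c'")
proof -
  interpret L: real_distribution L by fact
  interpret L': real_distribution L' by fact
  define D where "D c y = 1 / (2 * s) * (norm (B *v y - B *v c))\<^sup>2" for c y
  define M where "M = gauss_moment2 TYPE(real^'m) t"
  have excess: "(\<integral>\<^sup>+ y. ennreal (D c y) * ennreal (mix t (r *\<^sub>R e) L (y - \<theta>)) \<partial>lborel) =
      ?k * M + ?k * ?n c" for c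
  proof -
    have "(\<integral>\<^sup>+ y. ennreal (D c y) * ennreal (mix t (r *\<^sub>R e) L (y - \<theta>)) \<partial>lborel) =
        (\<integral>\<^sup>+ z. ennreal (1 / (2 * s) * (norm (z - B *v c))\<^sup>2) * ennreal (gauss t (z - B *v \<theta>)) \<partial>lborel)"
      unfolding D_def by (rule nn_integral_mix_complement[OF L t]) measurable
    also have "\<dots> = (\<integral>\<^sup>+ z. ?k * ennreal ((norm (z - B *v c))\<^sup>2 * gauss t (z - B *v \<theta>)) \<partial>lborel)"
      using s t by (simp add: ennreal_mult[symmetric] gauss_pos less_imp_le)
    also have "\<dots> = ?k * (M + ennreal ((norm (B *v \<theta> - B *v c))\<^sup>2))"
      by (simp add: nn_integral_cmult nn_integral_gauss_sqdist t M_def)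
    finally show ?thesis by (simp add: distrib_left norm_minus_commute)
  qed
  have ratio: "mix s (r *\<^sub>R e) L' (y - c') = mix s (r *\<^sub>R e) L' (y - c) * exp (D c y - D c' y)" for y
    using s by (simp add: mix_axis_split inner_diff_right c matrix_vector_mult_diff_distrib gauss_def D_def
        flip: exp_add)
  have "?K c' + (?k * M + ?k * ?n c) = ?K c + (?k * M + ?k * ?n c')"
    unfolding excess[symmetric]
    by (rule kl_div_change_reference)
      (use s t in \<open>auto simp: L.mix_pos L'.mix_pos L'.nn_integral_mix D_def\<close>, use ratio in \<open>simp add: D_def\<close>)
  then have "?k * M + (?K c' + ?k * ?n c) = ?k * M + (?K c + ?k * ?n c')"
    by (simp only: add.left_commute)
  moreover have "?k * M \<noteq> \<infinity>"
    using gauss_moment2_finite[OF t, where 'a="real^'m"] by (auto simp: M_def ennreal_mult_eq_top_iff)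
  ultimately show ?thesis
    unfolding ennreal_add_left_cancel by blast
qed

end

section \<open>Comparison of the risks\<close>

text \<open>This is why the risk of the equivariant predictive density does not depend on the location
  parameter.\<close>

lemma nn_integral_kl_div_translation:
  fixes P Q :: "'a::euclidean_space \<Rightarrow> real" and G :: "'a \<Rightarrow> real"
  assumes [measurable]: "P \<in> borel_measurable borel" "Q \<in> borel_measurable borel" "G \<in> borel_measurable borel"
  shows "(\<integral>\<^sup>+ x. kl_div (\<lambda>y. Q (y - \<theta>)) (\<lambda>y. G (y - x)) * ennreal (P (x - \<theta>)) \<partial>lborel) =
         (\<integral>\<^sup>+ x. kl_div Q (\<lambda>y. G (y - x)) * ennreal (P x) \<partial>lborel)"
proof -
  have "kl_div (\<lambda>y. Q (y - \<theta>)) (\<lambda>y. G (y - (\<theta> + x))) = kl_div Q (\<lambda>y. G (y - x))" for x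
    unfolding kl_div_def
    by (subst nn_integral_lborel_shift[of _ \<theta>, symmetric]) (simp_all add: algebra_simps)
  moreover have "(\<lambda>x. kl_div (\<lambda>y. Q (y - \<theta>)) (\<lambda>y. G (y - x)) * ennreal (P (x - \<theta>))) \<in> borel_measurable borel"
    unfolding kl_div_def by measurable
  ultimately show ?thesis
    by (subst nn_integral_lborel_shift[of _ \<theta>, symmetric]) simp_all
qed

lemma sq_risk_mat:
  assumes "0 < s" and [measurable]: "f \<in> borel_measurable borel"
  shows "sq_risk (mat s) \<zeta> f = (\<integral>\<^sup>+ z. ennreal ((norm (f z - \<zeta>))\<^sup>2) * ennreal (gauss s (z - \<zeta>)) \<partial>lborel)"
  using assms(1) unfolding sq_risk_def mvn_def mvn_density_mat[OF assms(1)]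
  by (subst nn_integral_density) (simp_all add: mult.commute)

lemma mmn_density_1:
  assumes "0 < s"
  shows "mmn_density (vec u :: real^1) (vec r) (mat s) L (vec t) = mix s r L (t - u)"
proof -
  have "gauss s (vec c :: real^1) = gauss s c" for c
    by (simp add: gauss_def norm_real)
  moreover have "vec t - vec u - v *\<^sub>R vec r = (vec (t - u - v *\<^sub>R r) :: real^1)" for v
    by (simp add: vec_eq_iff)
  ultimately show ?thesis
    using assms by (simp add: mmn_density_mat mix_def)
qed

context axis_split
begin

text \<open>The split predictive density is the equivariant one centred not at the observation \<open>x\<close> but at
  the point with the same coordinate along the axis whose complement part is the estimate.\<close>

definition recentre :: "(real^'m \<Rightarrow> real^'m) \<Rightarrow> real^'n \<Rightarrow> real^'n" where
  "recentre \<zeta>hat x = (e \<bullet> x) *\<^sub>R e + \<zeta>hat (B *v x) v* B"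

lemma axis_recentre: "e \<bullet> recentre \<zeta>hat x = e \<bullet> x"
  and complement_recentre: "B *v recentre \<zeta>hat x = \<zeta>hat (B *v x)"
  by (simp_all only: recentre_def axis_coord complement_coord)

lemma split_density_eq_mix:
  assumes "0 < s" "0 < r"
  shows "split_density (r *\<^sub>R e) s L e B \<zeta>hat x y = mix s (r *\<^sub>R e) L (y - recentre \<zeta>hat x)"
proof -
  have "norm (r *\<^sub>R e) = r"
    using assms axis_unit by (simp add: norm_eq_1)
  then show ?thesis
    using assms unfolding split_density_def
    by (simp add: mmn_density_1 mvn_density_mat mix_axis_split inner_diff_right
        matrix_vector_mult_diff_distrib axis_recentre complement_recentre)
qed

text \<open>The pointwise identity of the divergences, integrated over the observation. It is stated as an
  equality of sums because \<open>R\<close> and the risk of \<open>\<zeta>hat\<close> may be infinite.\<close>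

lemma kl_risk_exchange:
  assumes L1: "real_distribution L1" and L2: "real_distribution L2" and L: "real_distribution L"
    and pos: "0 < sX" "0 < sY" "0 < s" "0 < r"
    and [measurable]: "\<zeta>hat \<in> borel_measurable borel"
  defines "a \<equiv> r *\<^sub>R e"
  defines "p \<equiv> \<lambda>\<theta>. mmn_density \<theta> a (mat sX) L1" and "q \<equiv> \<lambda>\<theta>. mmn_density \<theta> a (mat sY) L2"
  obtains R U where
    "\<And>\<theta>. kl_risk p q \<theta> (split_density a s L e B \<zeta>hat) = enn2ereal (R \<theta>)"
    "\<And>\<theta>. kl_risk p q \<theta> (mre_density a s L) = enn2ereal U"
    "\<And>\<theta>. R \<theta> + ennreal (1 / (2 * s)) * sq_risk (mat sX) (B *v \<theta>) (\<lambda>z. z) =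
          U + ennreal (1 / (2 * s)) * sq_risk (mat sX) (B *v \<theta>) \<zeta>hat"
proof -
  interpret L1: real_distribution L1 by fact
  interpret L2: real_distribution L2 by fact
  interpret L: real_distribution L by fact
  let ?k = "ennreal (1 / (2 * s))"
  let ?q = "\<lambda>\<theta> y. mix sY a L2 (y - \<theta>)" and ?p = "\<lambda>\<theta> x. mix sX a L1 (x - \<theta>)"
  have p: "p = ?p" and q: "q = ?q"
    using pos by (simp_all add: p_def q_def mmn_density_mat fun_eq_iff)
  have mre: "mre_density a s L = (\<lambda>x y. mix s a L (y - x))"
    using pos by (simp add: mre_density_def mmn_density_mat fun_eq_iff)
  have split: "split_density a s L e B \<zeta>hat = (\<lambda>x y. mix s a L (y - recentre \<zeta>hat x))"
    using pos by (simp add: a_def split_density_eq_mix fun_eq_iff)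
  have [measurable]: "recentre \<zeta>hat \<in> borel_measurable borel"
    unfolding recentre_def transpose_matrix_vector[symmetric] by measurable
  define R where "R \<theta> = (\<integral>\<^sup>+ x. kl_div (?q \<theta>) (\<lambda>y. mix s a L (y - recentre \<zeta>hat x)) * ennreal (?p \<theta> x) \<partial>lborel)" for \<theta>
  define U where "U = (\<integral>\<^sup>+ x. kl_div (mix sY a L2) (\<lambda>y. mix s a L (y - x)) * ennreal (mix sX a L1 x) \<partial>lborel)"
  have U: "(\<integral>\<^sup>+ x. kl_div (?q \<theta>) (\<lambda>y. mix s a L (y - x)) * ennreal (?p \<theta> x) \<partial>lborel) = U" for \<theta>
    unfolding U_def by (rule nn_integral_kl_div_translation) measurable
  have [measurable]: "(\<lambda>x. kl_div (?q \<theta>) (\<lambda>y. mix s a L (y - x))) \<in> borel_measurable borel"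
    "(\<lambda>x. kl_div (?q \<theta>) (\<lambda>y. mix s a L (y - recentre \<zeta>hat x))) \<in> borel_measurable borel" for \<theta>
    unfolding kl_div_def by measurable
  have marginal: "(\<integral>\<^sup>+ x. (?k * ennreal ((norm (f (B *v x) - B *v \<theta>))\<^sup>2)) * ennreal (?p \<theta> x) \<partial>lborel) =
      ?k * sq_risk (mat sX) (B *v \<theta>) f" if [measurable]: "f \<in> borel_measurable borel" for f \<theta>
  proof -
    have "(\<integral>\<^sup>+ x. (?k * ennreal ((norm (f (B *v x) - B *v \<theta>))\<^sup>2)) * ennreal (?p \<theta> x) \<partial>lborel) =
      (\<integral>\<^sup>+ z. (?k * ennreal ((norm (f z - B *v \<theta>))\<^sup>2)) * ennreal (gauss sX (z - B *v \<theta>)) \<partial>lborel)"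
      unfolding a_def by (rule nn_integral_mix_complement[OF L1 pos(1)]) measurable
    then show ?thesis
      by (simp add: sq_risk_mat pos mult.assoc nn_integral_cmult)
  qed
  have pointwise: "kl_div (?q \<theta>) (\<lambda>y. mix s a L (y - recentre \<zeta>hat x)) + ?k * ennreal ((norm (B *v x - B *v \<theta>))\<^sup>2) =
      kl_div (?q \<theta>) (\<lambda>y. mix s a L (y - x)) + ?k * ennreal ((norm (\<zeta>hat (B *v x) - B *v \<theta>))\<^sup>2)" for x \<theta>
    using kl_div_recentre[OF L2 L pos(2,3), of "recentre \<zeta>hat x" x r \<theta>]
    by (simp add: a_def axis_recentre complement_recentre)
  show thesis
  proof
    fix \<theta>
    show "kl_risk p q \<theta> (split_density a s L e B \<zeta>hat) = enn2ereal (R \<theta>)"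
      unfolding p q split R_def using pos
      by (intro kl_risk_eq_nn_integral)
        (auto simp: L1.mix_pos L2.mix_pos L.mix_pos L2.nn_integral_mix L.nn_integral_mix)
    show "kl_risk p q \<theta> (mre_density a s L) = enn2ereal U"
      unfolding p q mre U[of \<theta>, symmetric] using pos
      by (intro kl_risk_eq_nn_integral)
        (auto simp: L1.mix_pos L2.mix_pos L.mix_pos L2.nn_integral_mix L.nn_integral_mix)
    have "R \<theta> + ?k * sq_risk (mat sX) (B *v \<theta>) (\<lambda>z. z) =
        (\<integral>\<^sup>+ x. (kl_div (?q \<theta>) (\<lambda>y. mix s a L (y - recentre \<zeta>hat x)) +
          ?k * ennreal ((norm (B *v x - B *v \<theta>))\<^sup>2)) * ennreal (?p \<theta> x) \<partial>lborel)"
      unfolding R_def distrib_right by (simp add: nn_integral_add flip: marginal)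
    also have "\<dots> = U + ?k * sq_risk (mat sX) (B *v \<theta>) \<zeta>hat"
      unfolding pointwise distrib_right U[of \<theta>, symmetric] by (simp add: nn_integral_add flip: marginal)
    finally show "R \<theta> + ?k * sq_risk (mat sX) (B *v \<theta>) (\<lambda>z. z) = U + ?k * sq_risk (mat sX) (B *v \<theta>) \<zeta>hat" .
  qed
qed

end

text \<open>The risk is the trace of the covariance; its finiteness allows cancelling it in the exchange identity.\<close>

lemma sq_risk_identity_finite:
  assumes "0 < s"
  shows "sq_risk (mat s) (\<zeta> :: real^'m) (\<lambda>z. z) < \<infinity>"
proof -
  have "sq_risk (mat s) \<zeta> (\<lambda>z. z) = gauss_moment2 TYPE(real^'m) s"
    using assms nn_integral_gauss_sqdist[OF assms, of \<zeta> \<zeta>]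
    by (simp add: sq_risk_mat ennreal_mult less_imp_le gauss_pos)
  then show ?thesis using gauss_moment2_finite[OF assms, where 'a="real^'m"] by simp
qed

lemma power2_norm_vec: "(norm v)\<^sup>2 = (\<Sum>i\<in>UNIV. (v $ i)\<^sup>2)" for v :: "real^'k"
  unfolding power2_norm_eq_inner inner_vec_def by (simp add: power2_eq_square)

lemma axis_split_orthogonal_matrix:
  fixes H :: "real^'n^'n" and rest :: "'m::finite \<Rightarrow> 'n"
  assumes H: "orthogonal_matrix H" and rest: "bij_betw rest UNIV (- {first})"
  shows "axis_split (row first H) (\<chi> j. row (rest j) H)"
proof
  let ?B = "(\<chi> j. row (rest j) H) :: real^'n^'m"
  have inj: "inj rest" and range: "range rest = - {first}"
    using rest by (auto simp: bij_betw_def)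
  have orth: "row i H \<bullet> row j H = (if i = j then 1 else 0)" for i j
    using H unfolding orthogonal_matrix_orthonormal_rows
    by (auto simp: norm_eq_1 orthogonal_def)
  have rest_neq: "rest j \<noteq> first" for j using range by blast
  have Bv: "(?B *v x) $ j = row (rest j) H \<bullet> x" for x j
    by (simp add: matrix_vector_mult_def inner_vec_def)
  have Hv: "(H *v x) $ i = row i H \<bullet> x" for x i
    by (simp add: matrix_vector_mult_def inner_vec_def row_def)
  have tB: "w v* ?B = (\<Sum>j\<in>UNIV. w $ j *\<^sub>R row (rest j) H)" for w
    by (simp add: vector_matrix_mult_def vec_eq_iff mult.commute)
  show "(norm x)\<^sup>2 = (row first H \<bullet> x)\<^sup>2 + (norm (?B *v x))\<^sup>2" for x
  proof -
    have "norm (H *v x) = norm x"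
      using H by (metis orthogonal_transformation_matrix orthogonal_transformation_norm
          matrix_of_matrix_vector_mul matrix_vector_mul_linear)
    then have "(norm x)\<^sup>2 = (\<Sum>i\<in>UNIV. (row i H \<bullet> x)\<^sup>2)"
      using power2_norm_vec[of "H *v x"] by (simp add: Hv)
    also have "\<dots> = (row first H \<bullet> x)\<^sup>2 + (\<Sum>i\<in>- {first}. (row i H \<bullet> x)\<^sup>2)"
      by (subst sum.remove[of _ first]) (auto simp: Compl_eq_Diff_UNIV)
    also have "(\<Sum>i\<in>- {first}. (row i H \<bullet> x)\<^sup>2) = (\<Sum>j\<in>UNIV. (row (rest j) H \<bullet> x)\<^sup>2)"
      by (rule sum.reindex_bij_betw[OF rest, symmetric])
    finally show ?thesis by (simp add: power2_norm_vec[of "?B *v x"] Bv)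
  qed
  show "row first H \<bullet> (t *\<^sub>R row first H + w v* ?B) = t" for t w
    by (simp add: tB inner_add_right inner_sum_right orth rest_neq[symmetric])
  show "?B *v (t *\<^sub>R row first H + w v* ?B) = w" for t w
    using inj by (simp add: vec_eq_iff Bv)
      (simp add: tB inner_add_right inner_sum_right orth rest_neq inj_eq if_distrib cong: if_cong)
  have "CARD('m) = card (- {first})" using rest by (rule bij_betw_same_card)
  moreover have "CARD('n) = Suc (card (- {first}))"
    using card_Suc_Diff1[of UNIV first] by (simp add: Compl_eq_Diff_UNIV)
  ultimately show "CARD('n) = 1 + CARD('m)" by simp
qed

lemma ennreal_exchange_le:
  fixes A U b c :: ennreal
  assumes eq: "A + c = U + b" and fin: "U < \<infinity>" "c < \<infinity>"
  shows "A \<le> U \<longleftrightarrow> b \<le> c" and "U \<le> A \<longleftrightarrow> c \<le> b"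
proof -
  have fin': "U \<noteq> \<infinity>" "c \<noteq> \<infinity>" using fin by auto
  have "A \<le> U \<longleftrightarrow> c + A \<le> c + U" using fin' by (simp add: ennreal_add_left_cancel_le)
  also have "\<dots> \<longleftrightarrow> U + b \<le> U + c" by (simp add: eq[symmetric] add.commute)
  also have "\<dots> \<longleftrightarrow> b \<le> c" using fin' by (simp add: ennreal_add_left_cancel_le)
  finally show "A \<le> U \<longleftrightarrow> b \<le> c" .
  have "U \<le> A \<longleftrightarrow> c + U \<le> c + A" using fin' by (simp add: ennreal_add_left_cancel_le)
  also have "\<dots> \<longleftrightarrow> U + c \<le> U + b" by (simp add: eq[symmetric] add.commute)
  also have "\<dots> \<longleftrightarrow> c \<le> b" using fin' by (simp add: ennreal_add_left_cancel_le)
  finally show "U \<le> A \<longleftrightarrow> c \<le> b" .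
qed

theorem theorem4:
  fixes a h1 :: "real^'n"
    and \<sigma>X \<sigma>Y :: real
    and L1 L2 :: "real measure"
    and H :: "real^'n^'n"
    and H2 :: "real^'n^'m"
    and first :: 'n
    and rest :: "'m \<Rightarrow> 'n"
    and \<zeta>hat :: "real^'m \<Rightarrow> real^'m"
    and p q :: "real^'n \<Rightarrow> real^'n \<Rightarrow> real"
  assumes "4 \<le> CARD('n)"
    and "a \<noteq> 0"
    and "0 < \<sigma>X" and "0 < \<sigma>Y"
    and "real_distribution L1" and "real_distribution L2"
    and "p = (\<lambda>\<theta>. mmn_density \<theta> a (mat (\<sigma>X\<^sup>2)) L1)"
    and "q = (\<lambda>\<theta>. mmn_density \<theta> a (mat (\<sigma>Y\<^sup>2)) L2)"
    and "orthogonal_matrix H"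
    and "h1 = a /\<^sub>R norm a"
    and "bij_betw rest UNIV (- {first})"
    and "row first H = h1"
    and "H2 = (\<chi> j. row (rest j) H)"
    and "\<zeta>hat \<in> borel_measurable borel"
    and "\<exists>\<theta>. kl_risk p q \<theta> (mre_density a (\<sigma>X\<^sup>2 + \<sigma>Y\<^sup>2) (diff_law L1 L2)) < \<infinity>"
  shows "dominates (kl_risk p q)
           (split_density a (\<sigma>X\<^sup>2 + \<sigma>Y\<^sup>2) (diff_law L1 L2) h1 H2 \<zeta>hat)
           (mre_density a (\<sigma>X\<^sup>2 + \<sigma>Y\<^sup>2) (diff_law L1 L2))
         \<longleftrightarrow> dominates (sq_risk (mat (\<sigma>X\<^sup>2))) \<zeta>hat (\<lambda>z. z)"
proof -
  interpret axis_split h1 H2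
    using axis_split_orthogonal_matrix[OF assms(9,11)] assms(12,13) by simp
  define s where "s = \<sigma>X\<^sup>2 + \<sigma>Y\<^sup>2"
  let ?k = "ennreal (1 / (2 * s))" and ?S = "sq_risk (mat (\<sigma>X\<^sup>2))"
  have pos: "0 < \<sigma>X\<^sup>2" "0 < \<sigma>Y\<^sup>2" "0 < s" "0 < norm a"
    using assms(2,3,4) by (simp_all add: s_def add_pos_pos)
  have a: "norm a *\<^sub>R h1 = a" using assms(2,10) by simp
  obtain R U where
    R: "\<And>\<theta>. kl_risk p q \<theta> (split_density a s (diff_law L1 L2) h1 H2 \<zeta>hat) = enn2ereal (R \<theta>)"
    and U: "\<And>\<theta>. kl_risk p q \<theta> (mre_density a s (diff_law L1 L2)) = enn2ereal U"
    and exchange: "\<And>\<theta>. R \<theta> + ?k * ?S (H2 *v \<theta>) (\<lambda>z. z) = U + ?k * ?S (H2 *v \<theta>) \<zeta>hat"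
    using kl_risk_exchange[OF assms(5,6) real_distribution_diff_law[OF assms(5,6)] pos assms(14),
        unfolded a, folded assms(7,8)] by blast
  have "U < \<infinity>" using assms(15) by (auto simp: U s_def[symmetric] less_ennreal.rep_eq)
  have k: "0 < ?k" "?k < \<infinity>" using pos by auto
  have le: "R \<theta> \<le> U \<longleftrightarrow> ?S (H2 *v \<theta>) \<zeta>hat \<le> ?S (H2 *v \<theta>) (\<lambda>z. z)"
    and ge: "U \<le> R \<theta> \<longleftrightarrow> ?S (H2 *v \<theta>) (\<lambda>z. z) \<le> ?S (H2 *v \<theta>) \<zeta>hat" for \<theta>
    using ennreal_exchange_le[OF exchange \<open>U < \<infinity>\<close>, of \<theta>] k
      sq_risk_identity_finite[OF pos(1), of "H2 *v \<theta>"]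
    by (simp_all add: ennreal_mult_le_mult_iff ennreal_mult_less_top)
  have less: "R \<theta> < U \<longleftrightarrow> ?S (H2 *v \<theta>) \<zeta>hat < ?S (H2 *v \<theta>) (\<lambda>z. z)" for \<theta>
    using le ge by (simp add: less_le_not_le)
  have surj: "\<exists>\<theta>. H2 *v \<theta> = \<zeta>" for \<zeta> using complement_coord[of 0 \<zeta>] by blast
  show ?thesis
    unfolding dominates_def s_def[symmetric] R U less_eq_ennreal.rep_eq[symmetric]
      less_ennreal.rep_eq[symmetric] le less
    using surj by metis
qed

end
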